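(* Let $K\subset\mathbb{R}^n$ be a nonempty compact set and $H$ a linear subspace of $\mathbb{R}^n$ with $1\le\dim H\le n-1$. Then the sequence $K_m:=F_H^mK$ ($F_H$ applied $m$ times) converges in the Hausdorff metric to the $H$-symmetric compact set \[L=\bigcup_{x\in H}\mathrm{conv}\big(F_HK\cap(x+H^\perp)\big).\]
   Context: For a linear subspace $H$, $H^\perp$ is its orthogonal complement, $x|H$ the orthogonal projection, and $R_Hx=2(x|H)-x$ the reflection with respect to $H$. Minkowski sum: $X+Y=\{x+y:x\in X,y\in Y\}$, $tX=\{tx\}$. The fiber symmetrization of a compact set $C$ is \[F_HC:=\bigcup_{x\in H}\Big[\tfrac12\big(C\cap(H^\perp+x)\big)+\tfrac12\big(R_HC\cap(H^\perp+x)\big)\Big].\] $\mathrm{conv}$ denotes convex hull. *)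

theory Defs
  imports "HOL-Analysis.Analysis"
begin

text \<open>Orthogonal projection of x onto a linear subspace H (written x|H in the paper):
  the unique y in H with x - y orthogonal to H.\<close>
definition proj_sub :: "'a::euclidean_space set \<Rightarrow> 'a \<Rightarrow> 'a" where
  "proj_sub H x = (THE y. y \<in> H \<and> x - y \<in> orthogonal_comp H)"

text \<open>Reflection with respect to H: R_H x = 2 (x|H) - x.\<close>
definition refl_sub :: "'a::euclidean_space set \<Rightarrow> 'a \<Rightarrow> 'a" where
  "refl_sub H x = 2 *\<^sub>R proj_sub H x - x"

text \<open>Minkowski sum and scaling, written out explicitly.\<close>
definition msum :: "'a::real_vector set \<Rightarrow> 'a set \<Rightarrow> 'a set" where
  "msum X Y = {x + y | x y. x \<in> X \<and> y \<in> Y}"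

text \<open>Fiber symmetrization F_H C.\<close>
definition fiber_sym :: "'a::euclidean_space set \<Rightarrow> 'a set \<Rightarrow> 'a set" where
  "fiber_sym H C = (\<Union>x\<in>H.
      msum ((*\<^sub>R) (1/2) ` (C \<inter> (\<lambda>y. y + x) ` orthogonal_comp H))
           ((*\<^sub>R) (1/2) ` (refl_sub H ` C \<inter> (\<lambda>y. y + x) ` orthogonal_comp H)))"

text \<open>Hausdorff distance (used between nonempty compact sets).\<close>
definition hausdorff_dist :: "'a::metric_space set \<Rightarrow> 'a set \<Rightarrow> real" where
  "hausdorff_dist A B = max (SUP a\<in>A. infdist a B) (SUP b\<in>B. infdist b A)"

end

theory Submission
  imports Defs
begin

text \<open>Write P for the projection onto H and R for the reflection. A point of F_H C is the
  midpoint of a and R b for some a, b in C over a common point of H. Since F_H C is R-invariant,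
  from K1 = F_H K on each further application of F_H just takes midpoints of pairs of points in a
  common fiber of P. Hence the iterates F_H^m K1 lie in the fiberwise convex hull L of K1 and
  contain every mean of 2^m points of one fiber of K1. By Caratheodory a point of L is a convex
  combination of at most n + 1 points of one fiber, and rounding its weights to multiples of 2^-m
  gives such a mean within (n + 1) diam K1 / 2^m. So the Hausdorff distance to L decays
  geometrically.\<close>

lemma proj_sub_unique:
  assumes H: "subspace H" and y: "y \<in> H" and z: "z \<in> orthogonal_comp H"
  shows "proj_sub H (y + z) = y"
  unfolding proj_sub_def
proof (rule the_equality)
  show "y \<in> H \<and> y + z - y \<in> orthogonal_comp H" using y z by simp
next
  fix y' assume y': "y' \<in> H \<and> y + z - y' \<in> orthogonal_comp H"
  have "y - y' \<in> H" using y y' H by (simp add: subspace_diff)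
  moreover have "y - y' \<in> orthogonal_comp H"
    using subspace_diff[OF subspace_orthogonal_comp, of "y + z - y'" H z] y' z
    by (simp add: algebra_simps)
  ultimately have "(y - y') \<bullet> (y - y') = 0"
    unfolding orthogonal_comp_def orthogonal_def by blast
  then show "y' = y" by simp
qed

lemma proj_sub_decomp:
  assumes H: "subspace H"
  shows "proj_sub H c \<in> H" and "c - proj_sub H c \<in> orthogonal_comp H"
proof -
  obtain y z where y: "y \<in> span H" and z: "\<And>w. w \<in> span H \<Longrightarrow> orthogonal z w"
    and c: "c = y + z"
    using orthogonal_subspace_decomp_exists by blast
  have yH: "y \<in> H" using y H by (metis span_eq_iff)
  have zH: "z \<in> orthogonal_comp H"
    using z span_base unfolding orthogonal_comp_def by (auto simp: orthogonal_commute)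
  show "proj_sub H c \<in> H" "c - proj_sub H c \<in> orthogonal_comp H"
    using proj_sub_unique[OF H yH zH] c yH zH by simp_all
qed

lemma proj_sub_eq_iff:
  assumes H: "subspace H" and x: "x \<in> H"
  shows "proj_sub H c = x \<longleftrightarrow> c - x \<in> orthogonal_comp H"
  using proj_sub_unique[OF H x, of "c - x"] proj_sub_decomp[OF H, of c] by auto

lemma linear_proj_sub:
  assumes H: "subspace H"
  shows "linear (proj_sub H)"
proof (rule linearI)
  let ?P = "proj_sub H"
  note HP = proj_sub_decomp[OF H] and HO = subspace_orthogonal_comp[of H]
  fix a b :: 'a and r :: real
  have "a + b = (?P a + ?P b) + ((a - ?P a) + (b - ?P b))" by simp
  then show "?P (a + b) = ?P a + ?P b"
    using proj_sub_unique[OF H subspace_add[OF H HP(1) HP(1)] subspace_add[OF HO HP(2) HP(2)]]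
    by metis
  have "r *\<^sub>R a = r *\<^sub>R ?P a + r *\<^sub>R (a - ?P a)" by (simp add: algebra_simps)
  then show "?P (r *\<^sub>R a) = r *\<^sub>R ?P a"
    using proj_sub_unique[OF H subspace_scale[OF H HP(1)] subspace_scale[OF HO HP(2)]]
    by metis
qed

lemma linear_refl_sub: "subspace H \<Longrightarrow> linear (refl_sub H)"
  unfolding refl_sub_def using linear_proj_sub[of H]
  by (intro linearI) (auto simp: linear_add linear_scale algebra_simps)

lemma proj_sub_refl_sub:
  assumes H: "subspace H"
  shows "proj_sub H (refl_sub H c) = proj_sub H c"
proof -
  have "refl_sub H c = proj_sub H c + - (c - proj_sub H c)"
    by (simp add: refl_sub_def scaleR_2)
  then show ?thesis
    using proj_sub_unique[OF H] proj_sub_decomp[OF H] subspace_neg[OF subspace_orthogonal_comp]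
    by metis
qed

lemma refl_sub_refl_sub [simp]: "subspace H \<Longrightarrow> refl_sub H (refl_sub H c) = c"
  using proj_sub_refl_sub by (simp add: refl_sub_def)

lemma translate_orthogonal_comp_eq_fiber:
  assumes H: "subspace H" and x: "x \<in> H"
  shows "(\<lambda>y. y + x) ` orthogonal_comp H = proj_sub H -` {x}"
proof -
  have "c \<in> (\<lambda>y. y + x) ` orthogonal_comp H \<longleftrightarrow> c - x \<in> orthogonal_comp H" for c
    by (auto simp: image_iff intro: bexI[of _ "c - x"])
  then show ?thesis using proj_sub_eq_iff[OF H x] by auto
qed

lemma fiber_sym_eq_midpoints:
  assumes H: "subspace H"
  shows "fiber_sym H C =
    {midpoint a r | a r. a \<in> C \<and> r \<in> refl_sub H ` C \<and> proj_sub H a = proj_sub H r}"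
proof -
  have "fiber_sym H C =
      (\<Union>x\<in>H. {midpoint a r | a r. a \<in> C \<and> r \<in> refl_sub H ` C \<and>
                                  proj_sub H a = x \<and> proj_sub H r = x})"
    unfolding fiber_sym_def msum_def
    by (intro SUP_cong refl)
       (auto simp: translate_orthogonal_comp_eq_fiber[OF H] midpoint_def scaleR_add_right)
  also have "\<dots> = {midpoint a r | a r. a \<in> C \<and> r \<in> refl_sub H ` C \<and> proj_sub H a = proj_sub H r}"
    using proj_sub_decomp(1)[OF H] by fastforce
  finally show ?thesis .
qed

lemma proj_sub_midpoint:
  assumes H: "subspace H" and ab: "proj_sub H a = proj_sub H b"
  shows "proj_sub H (midpoint a b) = proj_sub H a"
  using midpoint_linear_image[OF linear_proj_sub[OF H], of a b] ab by simp

lemma refl_sub_image_fiber_sym: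
  assumes H: "subspace H"
  shows "refl_sub H ` fiber_sym H C = fiber_sym H C"
proof -
  have sub: "refl_sub H ` fiber_sym H C \<subseteq> fiber_sym H C"
  proof
    fix z assume "z \<in> refl_sub H ` fiber_sym H C"
    then obtain a b where ab: "a \<in> C" "b \<in> C" "proj_sub H a = proj_sub H (refl_sub H b)"
      and z: "z = refl_sub H (midpoint a (refl_sub H b))"
      by (auto simp: fiber_sym_eq_midpoints[OF H])
    have "z = midpoint b (refl_sub H a)"
      by (simp add: z H midpoint_sym flip: midpoint_linear_image[OF linear_refl_sub[OF H]])
    then show "z \<in> fiber_sym H C"
      using ab unfolding fiber_sym_eq_midpoints[OF H] by (force simp: proj_sub_refl_sub[OF H])
  qed
  have "fiber_sym H C \<subseteq> refl_sub H ` fiber_sym H C"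
    using image_mono[OF sub, of "refl_sub H"] by (simp add: H image_comp comp_def)
  with sub show ?thesis by blast
qed

lemma fiber_sym_symmetric_eq_midpoints:
  assumes H: "subspace H" and C: "refl_sub H ` C = C"
  shows "fiber_sym H C = {midpoint a b | a b. a \<in> C \<and> b \<in> C \<and> proj_sub H a = proj_sub H b}"
  using fiber_sym_eq_midpoints[OF H, of C] by (simp add: C)

lemma fiber_sym_nonempty: "subspace H \<Longrightarrow> C \<noteq> {} \<Longrightarrow> fiber_sym H C \<noteq> {}"
  by (auto simp: fiber_sym_eq_midpoints proj_sub_refl_sub)

lemma compact_fiber_sym:
  assumes H: "subspace H" and C: "compact C"
  shows "compact (fiber_sym H C)"
proof -
  let ?P = "proj_sub H"
  let ?S = "(C \<times> refl_sub H ` C) \<inter> {p. ?P (fst p) = ?P (snd p)}"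
  have cont: "continuous_on UNIV ?P" "continuous_on UNIV (refl_sub H)"
    using linear_proj_sub[OF H] linear_refl_sub[OF H]
    by (auto intro: linear_continuous_on simp: linear_conv_bounded_linear)
  have "closed {p. ?P (fst p) = ?P (snd p)}"
    by (intro closed_Collect_eq continuous_intros continuous_on_compose2[OF cont(1)]) auto
  moreover have "compact (refl_sub H ` C)"
    using compact_continuous_image[OF continuous_on_subset[OF cont(2)] C] by simp
  ultimately have "compact ?S" using C by (intro compact_Int_closed compact_Times)
  then have "compact ((\<lambda>p. midpoint (fst p) (snd p)) ` ?S)"
    by (intro compact_continuous_image) (auto simp: midpoint_def intro!: continuous_intros)
  moreover have "(\<lambda>p. midpoint (fst p) (snd p)) ` ?S = fiber_sym H C"
    unfolding fiber_sym_eq_midpoints[OF H] by force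
  ultimately show ?thesis by simp
qed

lemma compact_funpow_fiber_sym:
  "subspace H \<Longrightarrow> compact C \<Longrightarrow> compact ((fiber_sym H ^^ m) C)"
  by (induction m) (simp_all add: compact_fiber_sym)

lemma funpow_fiber_sym_nonempty:
  "subspace H \<Longrightarrow> C \<noteq> {} \<Longrightarrow> (fiber_sym H ^^ m) C \<noteq> {}"
  by (induction m) (simp_all add: fiber_sym_nonempty)

lemma refl_sub_image_funpow_fiber_sym:
  "subspace H \<Longrightarrow> refl_sub H ` C = C \<Longrightarrow> refl_sub H ` (fiber_sym H ^^ m) C = (fiber_sym H ^^ m) C"
  by (cases m) (simp_all add: refl_sub_image_fiber_sym)

definition fiberwise_convex_hull :: "('a::real_vector \<Rightarrow> 'b) \<Rightarrow> 'a set \<Rightarrow> 'a set" where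
  "fiberwise_convex_hull f A = (\<Union>x. convex hull (A \<inter> f -` {x}))"

text \<open>Each step adds one convex combination with a point of A in the same fiber; this keeps
  compactness, and by Caratheodory DIM('a) steps exhaust the fiberwise convex hull.\<close>

primrec fiberwise_combinations :: "('a::real_vector \<Rightarrow> 'b) \<Rightarrow> 'a set \<Rightarrow> nat \<Rightarrow> 'a set" where
  "fiberwise_combinations f A 0 = A"
| "fiberwise_combinations f A (Suc n) =
     {(1 - t) *\<^sub>R y + t *\<^sub>R z | y z t.
        y \<in> fiberwise_combinations f A n \<and> z \<in> A \<and> 0 \<le> t \<and> t \<le> 1 \<and> f y = f z}"

lemma compact_fiberwise_combinations:
  fixes f :: "'a::real_normed_vector \<Rightarrow> 'b::t2_space"
  assumes f: "continuous_on UNIV f" and A: "compact A"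
  shows "compact (fiberwise_combinations f A n)"
proof (induction n)
  case 0
  then show ?case using A by simp
next
  case (Suc n)
  let ?S = "(fiberwise_combinations f A n \<times> A \<times> {0..1::real}) \<inter> {p. f (fst p) = f (fst (snd p))}"
  let ?g = "\<lambda>p. (1 - snd (snd p)) *\<^sub>R fst p + snd (snd p) *\<^sub>R fst (snd p)"
  have "closed {p :: 'a \<times> 'a \<times> real. f (fst p) = f (fst (snd p))}"
    by (intro closed_Collect_eq continuous_on_compose2[OF f] continuous_intros) auto
  then have "compact ?S" using A Suc.IH by (intro compact_Int_closed compact_Times) auto
  then have "compact (?g ` ?S)"
    by (intro compact_continuous_image continuous_intros)
  moreover have "?g ` ?S = fiberwise_combinations f A (Suc n)" by force
  ultimately show ?case by simp
qed

lemma subset_fiberwise_combinations: "A \<subseteq> fiberwise_combinations f A n"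
proof (induction n)
  case (Suc n)
  show ?case
  proof
    fix y assume "y \<in> A"
    then show "y \<in> fiberwise_combinations f A (Suc n)"
      using Suc.IH by (auto intro!: exI[of _ y] exI[of _ "0::real"])
  qed
qed simp

lemma fiberwise_combinations_subset_convex_hull:
  assumes f: "linear f"
  shows "y \<in> fiberwise_combinations f A n \<Longrightarrow> y \<in> convex hull (A \<inter> f -` {f y})"
proof (induction n arbitrary: y)
  case 0
  then show ?case by (simp add: hull_inc)
next
  case (Suc n)
  then obtain y0 z t where y0: "y0 \<in> fiberwise_combinations f A n" and z: "z \<in> A"
    and t: "0 \<le> t" "t \<le> 1" and fz: "f y0 = f z" and y: "y = (1 - t) *\<^sub>R y0 + t *\<^sub>R z"
    by auto
  have "f y = f y0"
    using f fz by (simp add: y linear_add linear_scale flip: scaleR_add_left)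
  moreover have "y \<in> convex hull (A \<inter> f -` {f y0})"
    using Suc.IH[OF y0] z fz t unfolding y
    by (intro convexD_alt convex_convex_hull) (auto intro: hull_inc)
  ultimately show ?case by simp
qed

lemma convex_hull_subset_fiberwise_combinations:
  assumes f: "linear f"
  shows "finite S \<Longrightarrow> S \<noteq> {} \<Longrightarrow> S \<subseteq> A \<inter> f -` {x} \<Longrightarrow> card S \<le> Suc n \<Longrightarrow>
    convex hull S \<subseteq> fiberwise_combinations f A n"
proof (induction S arbitrary: n rule: finite_ne_induct)
  case (singleton a)
  then show ?case using subset_fiberwise_combinations by auto
next
  case (insert a S)
  then obtain n' where n: "n = Suc n'" "card S \<le> Suc n'"
    by (cases n) auto
  have IH: "convex hull S \<subseteq> fiberwise_combinations f A n'" using insert n by auto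
  have fiber: "convex hull S \<subseteq> f -` {x}"
    using insert.prems(1) by (intro hull_minimal convex_linear_vimage[OF f]) auto
  show ?case
  proof
    fix y assume "y \<in> convex hull (insert a S)"
    then obtain u v b where uv: "0 \<le> u" "0 \<le> v" "u + v = 1" and b: "b \<in> convex hull S"
      and y: "y = u *\<^sub>R a + v *\<^sub>R b"
      unfolding convex_hull_insert[OF insert.hyps(2)] by blast
    have "y = (1 - u) *\<^sub>R b + u *\<^sub>R a" using uv(3) by (simp add: y eq_diff_eq')
    moreover have "b \<in> fiberwise_combinations f A n'" "f b = f a"
      using IH b fiber insert.prems(1) by auto
    ultimately show "y \<in> fiberwise_combinations f A n"
      using insert.prems(1) uv unfolding n by fastforce
  qed
qed

lemma fiberwise_convex_hull_eq_combinations: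
  fixes f :: "'a::euclidean_space \<Rightarrow> 'b::real_vector"
  assumes f: "linear f"
  shows "fiberwise_convex_hull f A = fiberwise_combinations f A DIM('a)"
proof
  show "fiberwise_convex_hull f A \<subseteq> fiberwise_combinations f A DIM('a)"
  proof
    fix y assume "y \<in> fiberwise_convex_hull f A"
    then obtain x where "y \<in> convex hull (A \<inter> f -` {x})"
      by (auto simp: fiberwise_convex_hull_def)
    then obtain S where S: "finite S" "S \<subseteq> A \<inter> f -` {x}" "card S \<le> DIM('a) + 1"
      and y: "y \<in> convex hull S"
      unfolding caratheodory[of "A \<inter> f -` {x}"] by blast
    have "S \<noteq> {}" using y by auto
    with S y show "y \<in> fiberwise_combinations f A DIM('a)"
      using convex_hull_subset_fiberwise_combinations[OF f] by simp blast
  qed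
  show "fiberwise_combinations f A DIM('a) \<subseteq> fiberwise_convex_hull f A"
    using fiberwise_combinations_subset_convex_hull[OF f]
    by (auto simp: fiberwise_convex_hull_def)
qed

lemma compact_fiberwise_convex_hull:
  fixes f :: "'a::euclidean_space \<Rightarrow> 'b::real_normed_vector"
  assumes f: "linear f" and A: "compact A"
  shows "compact (fiberwise_convex_hull f A)"
proof -
  have "continuous_on UNIV f"
    using f by (simp add: linear_continuous_on linear_conv_bounded_linear)
  then show ?thesis
    unfolding fiberwise_convex_hull_eq_combinations[OF f]
    using A by (rule compact_fiberwise_combinations)
qed

lemma fiberwise_convex_hull_proj_sub:
  assumes H: "subspace H"
  shows "fiberwise_convex_hull (proj_sub H) C =
    (\<Union>x\<in>H. convex hull (C \<inter> (\<lambda>y. y + x) ` orthogonal_comp H))"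
proof -
  have "convex hull (C \<inter> proj_sub H -` {x}) = {}" if "x \<notin> H" for x
    using proj_sub_decomp(1)[OF H] that by auto
  then have "fiberwise_convex_hull (proj_sub H) C = (\<Union>x\<in>H. convex hull (C \<inter> proj_sub H -` {x}))"
    unfolding fiberwise_convex_hull_def by blast
  then show ?thesis by (simp add: translate_orthogonal_comp_eq_fiber[OF H])
qed

lemma refl_sub_image_fiberwise_convex_hull:
  assumes H: "subspace H" and C: "refl_sub H ` C = C"
  shows "refl_sub H ` fiberwise_convex_hull (proj_sub H) C = fiberwise_convex_hull (proj_sub H) C"
proof -
  have "refl_sub H ` (C \<inter> proj_sub H -` {x}) = C \<inter> proj_sub H -` {x}" for x
  proof
    show "refl_sub H ` (C \<inter> proj_sub H -` {x}) \<subseteq> C \<inter> proj_sub H -` {x}"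
      using C proj_sub_refl_sub[OF H] by auto
    show "C \<inter> proj_sub H -` {x} \<subseteq> refl_sub H ` (C \<inter> proj_sub H -` {x})"
    proof
      fix c assume c: "c \<in> C \<inter> proj_sub H -` {x}"
      then have "refl_sub H c \<in> C \<inter> proj_sub H -` {x}"
        using C proj_sub_refl_sub[OF H] by auto
      then show "c \<in> refl_sub H ` (C \<inter> proj_sub H -` {x})"
        using refl_sub_refl_sub[OF H, of c] by (metis image_eqI)
    qed
  qed
  then show ?thesis
    by (simp add: fiberwise_convex_hull_def image_UN convex_hull_linear_image[OF linear_refl_sub[OF H]])
qed

lemma funpow_fiber_sym_in_convex_hull_fiber:
  assumes H: "subspace H" and C: "refl_sub H ` C = C"
  shows "c \<in> (fiber_sym H ^^ m) C \<Longrightarrow> c \<in> convex hull (C \<inter> proj_sub H -` {proj_sub H c})"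
proof (induction m arbitrary: c)
  case 0
  then show ?case by (simp add: hull_inc)
next
  case (Suc m)
  then obtain a b where ab: "a \<in> (fiber_sym H ^^ m) C" "b \<in> (fiber_sym H ^^ m) C"
    and P: "proj_sub H a = proj_sub H b" and c: "c = midpoint a b"
    using fiber_sym_symmetric_eq_midpoints[OF H refl_sub_image_funpow_fiber_sym[OF H C]] by auto
  have "midpoint a b \<in> convex hull (C \<inter> proj_sub H -` {proj_sub H a})"
    using Suc.IH[OF ab(1)] Suc.IH[OF ab(2)] P by (intro midpoints_in_convex_hull) auto
  then show ?case by (simp add: c proj_sub_midpoint[OF H P])
qed

lemma funpow_fiber_sym_subset_fiberwise_convex_hull:
  assumes H: "subspace H" and C: "refl_sub H ` C = C"
  shows "(fiber_sym H ^^ m) C \<subseteq> fiberwise_convex_hull (proj_sub H) C"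
  using funpow_fiber_sym_in_convex_hull_fiber[OF H C] by (auto simp: fiberwise_convex_hull_def)

lemma dyadic_mean_in_funpow_fiber_sym:
  assumes H: "subspace H" and C: "refl_sub H ` C = C"
  shows "length xs = 2 ^ m \<Longrightarrow> set xs \<subseteq> C \<inter> proj_sub H -` {x} \<Longrightarrow>
    sum_list xs /\<^sub>R 2 ^ m \<in> (fiber_sym H ^^ m) C \<inter> proj_sub H -` {x}"
proof (induction m arbitrary: xs)
  case 0
  then obtain c where "xs = [c]" by (auto simp: length_Suc_conv)
  then show ?case using 0 by auto
next
  case (Suc m)
  define ys zs where "ys = take (2 ^ m) xs" and "zs = drop (2 ^ m) xs"
  let ?Y = "sum_list ys /\<^sub>R 2 ^ m" and ?Z = "sum_list zs /\<^sub>R 2 ^ m"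
  have xs: "xs = ys @ zs" by (simp add: ys_def zs_def)
  have "length ys = 2 ^ m" "length zs = 2 ^ m" using Suc.prems(1) by (simp_all add: ys_def zs_def)
  moreover have "set ys \<subseteq> C \<inter> proj_sub H -` {x}" "set zs \<subseteq> C \<inter> proj_sub H -` {x}"
    using Suc.prems(2) by (auto simp: xs)
  ultimately have Y: "?Y \<in> (fiber_sym H ^^ m) C" "proj_sub H ?Y = x"
    and Z: "?Z \<in> (fiber_sym H ^^ m) C" "proj_sub H ?Z = x"
    using Suc.IH by blast+
  have "midpoint ?Y ?Z \<in> fiber_sym H ((fiber_sym H ^^ m) C)"
    unfolding fiber_sym_symmetric_eq_midpoints[OF H refl_sub_image_funpow_fiber_sym[OF H C]]
    using Y Z by (metis (mono_tags, lifting) mem_Collect_eq)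
  moreover have "sum_list xs /\<^sub>R 2 ^ Suc m = midpoint ?Y ?Z"
    by (simp add: xs midpoint_def scaleR_add_right)
  ultimately show ?case using proj_sub_midpoint[OF H] Y(2) Z(2) by simp
qed

lemma exists_list_with_counts:
  assumes "finite S"
  shows "\<exists>xs. set xs \<subseteq> S \<and> length xs = sum n S \<and>
    sum_list xs = (\<Sum>v\<in>S. real (n v) *\<^sub>R (v :: 'a::real_vector))"
  using assms
proof (induction S rule: finite_induct)
  case (insert a S)
  then obtain xs where "set xs \<subseteq> S" "length xs = sum n S"
    "sum_list xs = (\<Sum>v\<in>S. real (n v) *\<^sub>R v)"
    by blast
  moreover have "sum_list (replicate k a) = real k *\<^sub>R a" for k
    by (induction k) (simp_all add: algebra_simps)
  ultimately show ?case
    using insert.hyps by (intro exI[of _ "replicate (n a) a @ xs"]) auto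
qed simp

lemma exists_nat_rounding:
  assumes S: "finite S" and x: "x \<in> S" and N: "N > 0"
    and u: "\<And>v. v \<in> S \<Longrightarrow> 0 \<le> u v" "sum u S = 1"
  shows "\<exists>n :: 'a \<Rightarrow> nat. sum n S = N \<and>
    (\<forall>v\<in>S - {x}. \<bar>u v - real (n v) / real N\<bar> \<le> 1 / real N)"
proof -
  txt \<open>Round all weights down to multiples of 1/N and give the missing mass to x.\<close>
  define n where "n v = nat \<lfloor>real N * u v\<rfloor>" for v
  define T where "T = sum n (S - {x})"
  have floor: "real (n v) \<le> real N * u v \<and> real N * u v < real (n v) + 1" if "v \<in> S" for v
  proof -
    have "0 \<le> real N * u v" using u(1)[OF that] by simp
    then show ?thesis unfolding n_def by linarith
  qed
  have "real T \<le> (\<Sum>v\<in>S - {x}. real N * u v)"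
    unfolding T_def of_nat_sum using floor by (intro sum_mono) auto
  also have "\<dots> \<le> (\<Sum>v\<in>S. real N * u v)"
    using S u(1) by (intro sum_mono2) auto
  also have "\<dots> = real N" using u(2) by (simp flip: sum_distrib_left)
  finally have TN: "T \<le> N" by simp
  define n' where "n' v = (if v = x then N - T else n v)" for v
  have "sum n' S = n' x + sum n' (S - {x})" using S x by (simp add: sum.remove)
  also have "sum n' (S - {x}) = T" unfolding T_def n'_def by (intro sum.cong) auto
  finally have "sum n' S = N" using TN by (simp add: n'_def)
  moreover have "\<bar>u v - real (n' v) / real N\<bar> \<le> 1 / real N" if "v \<in> S - {x}" for v
  proof -
    have "real (n v) / real N \<le> u v" "u v \<le> real (n v) / real N + 1 / real N"
      using floor[of v] that N by (simp_all add: field_simps)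
    then show ?thesis using that by (simp add: n'_def abs_le_iff)
  qed
  ultimately show ?thesis by blast
qed

lemma dyadic_mean_approx_convex_hull:
  fixes S :: "'a::real_normed_vector set"
  assumes S: "finite S" and x: "x \<in> S" and R: "\<And>v. v \<in> S \<Longrightarrow> dist v x \<le> R"
    and l: "l \<in> convex hull S"
  shows "\<exists>xs. length xs = 2 ^ m \<and> set xs \<subseteq> S \<and>
    dist l (sum_list xs /\<^sub>R 2 ^ m) \<le> real (card S) * R / 2 ^ m"
proof -
  define N :: nat where "N = 2 ^ m"
  have N: "real N = 2 ^ m" "N > 0" by (simp_all add: N_def)
  obtain u where u: "\<And>v. v \<in> S \<Longrightarrow> 0 \<le> u v" "sum u S = 1" "(\<Sum>v\<in>S. u v *\<^sub>R v) = l"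
    using l S by (auto simp: convex_hull_finite)
  obtain n where n: "sum n S = N"
    and round: "\<And>v. v \<in> S - {x} \<Longrightarrow> \<bar>u v - real (n v) / real N\<bar> \<le> 1 / real N"
    using exists_nat_rounding[OF S x N(2) u(1,2)] by blast
  obtain xs where xs: "set xs \<subseteq> S" "length xs = N" "sum_list xs = (\<Sum>v\<in>S. real (n v) *\<^sub>R v)"
    using exists_list_with_counts[OF S, of n] n by blast
  let ?w = "\<lambda>v. u v - real (n v) / real N"
  have "(\<Sum>v\<in>S. real (n v)) = real N" using n by (simp flip: of_nat_sum)
  then have sum_n: "(\<Sum>v\<in>S. real (n v) / real N) = 1"
    using N by (simp flip: sum_divide_distrib)
  have "l - sum_list xs /\<^sub>R real N = (\<Sum>v\<in>S. u v *\<^sub>R v) - (\<Sum>v\<in>S. (real (n v) / real N) *\<^sub>R v)"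
    by (simp add: xs(3) u(3) scaleR_sum_right divide_inverse_commute)
  also have "\<dots> = (\<Sum>v\<in>S. ?w v *\<^sub>R v) - (\<Sum>v\<in>S. ?w v) *\<^sub>R x"
    by (simp add: sum_n u(2) sum_subtractf scaleR_left_diff_distrib)
  also have "\<dots> = (\<Sum>v\<in>S. ?w v *\<^sub>R (v - x))"
    by (simp add: scaleR_diff_right sum_subtractf flip: scaleR_sum_left)
  finally have "dist l (sum_list xs /\<^sub>R real N) \<le> (\<Sum>v\<in>S. norm (?w v *\<^sub>R (v - x)))"
    unfolding dist_norm by (metis norm_sum)
  also have "\<dots> \<le> (\<Sum>v\<in>S. R / real N)"
  proof (rule sum_mono)
    fix v assume v: "v \<in> S"
    show "norm (?w v *\<^sub>R (v - x)) \<le> R / real N"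
    proof (cases "v = x")
      case True
      then show ?thesis using R[OF x] N by simp
    next
      case False
      then have "\<bar>?w v\<bar> * norm (v - x) \<le> (1 / real N) * R"
        using round[of v] R[OF v] v by (intro mult_mono) (auto simp: dist_norm)
      then show ?thesis by simp
    qed
  qed
  finally show ?thesis using xs N by (auto simp: N_def)
qed

lemma fiberwise_convex_hull_near_funpow_fiber_sym:
  fixes C :: "'a::euclidean_space set"
  assumes H: "subspace H" and C: "refl_sub H ` C = C" "bounded C"
    and b: "b \<in> fiberwise_convex_hull (proj_sub H) C"
  shows "\<exists>c\<in>(fiber_sym H ^^ m) C. dist b c \<le> real (DIM('a) + 1) * diameter C / 2 ^ m"
proof -
  obtain x where "b \<in> convex hull (C \<inter> proj_sub H -` {x})"
    using b by (auto simp: fiberwise_convex_hull_def)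
  then obtain S where S: "finite S" "S \<subseteq> C \<inter> proj_sub H -` {x}" "card S \<le> DIM('a) + 1"
    and bS: "b \<in> convex hull S"
    unfolding caratheodory[of "C \<inter> proj_sub H -` {x}"] by blast
  then obtain x0 where x0: "x0 \<in> S" by fastforce
  have "dist v x0 \<le> diameter C" if "v \<in> S" for v
    using diameter_bounded_bound[OF C(2)] S(2) that x0 by blast
  then obtain xs where xs: "length xs = 2 ^ m" "set xs \<subseteq> S"
    and near: "dist b (sum_list xs /\<^sub>R 2 ^ m) \<le> real (card S) * diameter C / 2 ^ m"
    using dyadic_mean_approx_convex_hull[OF S(1) x0 _ bS] by blast
  have "sum_list xs /\<^sub>R 2 ^ m \<in> (fiber_sym H ^^ m) C"
    using dyadic_mean_in_funpow_fiber_sym[OF H C(1) xs(1)] xs(2) S(2) by blast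
  moreover have "real (card S) * diameter C / 2 ^ m \<le> real (DIM('a) + 1) * diameter C / 2 ^ m"
    using S(3) diameter_ge_0[OF C(2)] by (intro divide_right_mono mult_right_mono) auto
  ultimately show ?thesis using near by force
qed

lemma hausdorff_dist_subset_le:
  assumes A: "A \<noteq> {}" and AB: "A \<subseteq> B" and near: "\<And>b. b \<in> B \<Longrightarrow> \<exists>a\<in>A. dist b a \<le> \<delta>"
  shows "0 \<le> hausdorff_dist A B" and "hausdorff_dist A B \<le> \<delta>"
proof -
  have "(SUP a\<in>A. infdist a B) = (SUP a\<in>A. 0)"
    using AB by (intro SUP_cong) auto
  then have sup_A: "(SUP a\<in>A. infdist a B) = 0" using A by simp
  have "infdist b A \<le> \<delta>" if "b \<in> B" for b
    using near[OF that] infdist_le order_trans by blast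
  then have sup_B: "(SUP b\<in>B. infdist b A) \<le> \<delta>" using A AB by (intro cSUP_least) auto
  show "0 \<le> hausdorff_dist A B" "hausdorff_dist A B \<le> \<delta>"
    using sup_A sup_B near A AB unfolding hausdorff_dist_def
    by (auto intro: order_trans[OF zero_le_dist])
qed

lemma funpow_fiber_sym_hausdorff_tendsto:
  fixes C :: "'a::euclidean_space set"
  assumes H: "subspace H" and C: "refl_sub H ` C = C" "bounded C" "C \<noteq> {}"
  shows "(\<lambda>m. hausdorff_dist ((fiber_sym H ^^ m) C) (fiberwise_convex_hull (proj_sub H) C))
    \<longlonglongrightarrow> 0"
proof (rule Lim_null_comparison)
  let ?c = "real (DIM('a) + 1) * diameter C"
  show "\<forall>\<^sub>F m in sequentially.
    norm (hausdorff_dist ((fiber_sym H ^^ m) C) (fiberwise_convex_hull (proj_sub H) C)) \<le> ?c / 2 ^ m"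
    using hausdorff_dist_subset_le[OF funpow_fiber_sym_nonempty[OF H C(3)]
        funpow_fiber_sym_subset_fiberwise_convex_hull[OF H C(1)]
        fiberwise_convex_hull_near_funpow_fiber_sym[OF H C(1,2)]]
    by simp
  show "(\<lambda>m. ?c / 2 ^ m) \<longlonglongrightarrow> 0"
    by (intro LIMSEQ_divide_realpow_zero) simp
qed

theorem corollary7:
  fixes K H :: "'a::euclidean_space set"
  assumes "compact K" and "K \<noteq> {}"
    and "subspace H" and "1 \<le> dim H" and "dim H \<le> DIM('a) - 1"
  defines "L \<equiv> (\<Union>x\<in>H. convex hull (fiber_sym H K \<inter> (\<lambda>y. y + x) ` orthogonal_comp H))"
  shows "compact L \<and> L \<noteq> {} \<and> refl_sub H ` L = L \<and>
         (\<forall>m. compact ((fiber_sym H ^^ m) K) \<and> (fiber_sym H ^^ m) K \<noteq> {}) \<and>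
         (\<lambda>m. hausdorff_dist ((fiber_sym H ^^ m) K) L) \<longlonglongrightarrow> 0"
proof -
  note H = \<open>subspace H\<close>
  define K1 where "K1 = fiber_sym H K"
  have K1: "compact K1" "K1 \<noteq> {}" "refl_sub H ` K1 = K1"
    using compact_fiber_sym[OF H assms(1)] fiber_sym_nonempty[OF H assms(2)]
      refl_sub_image_fiber_sym[OF H] by (simp_all add: K1_def)
  have L: "L = fiberwise_convex_hull (proj_sub H) K1"
    by (simp add: L_def K1_def fiberwise_convex_hull_proj_sub[OF H])
  have "K1 \<subseteq> L"
    using funpow_fiber_sym_subset_fiberwise_convex_hull[OF H K1(3), of 0] by (simp add: L)
  moreover have "(\<lambda>m. hausdorff_dist ((fiber_sym H ^^ Suc m) K) L) \<longlonglongrightarrow> 0"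
    using funpow_fiber_sym_hausdorff_tendsto[OF H K1(3) compact_imp_bounded[OF K1(1)] K1(2)]
    by (simp add: L K1_def funpow_swap1)
  ultimately show ?thesis
    using compact_fiberwise_convex_hull[OF linear_proj_sub[OF H] K1(1)] K1(2)
      refl_sub_image_fiberwise_convex_hull[OF H K1(3)]
      compact_funpow_fiber_sym[OF H assms(1)] funpow_fiber_sym_nonempty[OF H assms(2)]
    by (auto simp: L intro: LIMSEQ_imp_Suc)
qed

end
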